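(* Let $M$ be a closed differentiable manifold. Then generic $f\in\mathcal{H}(M)$ is almost chain continuous, and generic $f\in\mathcal{C}(M)$ is almost chain continuous. That is, the set of almost chain continuous $f\in\mathcal{H}(M)$ contains a countable intersection of open dense subsets of $\mathcal{H}(M)$, and the set of almost chain continuous $f\in\mathcal{C}(M)$ contains a countable intersection of open dense subsets of $\mathcal{C}(M)$.
   Context: A closed manifold is a compact manifold without boundary; $M$ is endowed with a metric $d$ compatible with its topology. $\mathcal{H}(M)$ denotes the set of homeomorphisms of $M$ onto itself and $\mathcal{C}(M)$ the set of continuous maps $M\to M$, each endowed with the $C^0$-topology (the topology of uniform convergence; for $\mathcal{C}(M)$ it is induced by the metric $\sup_{x\in M}d(f(x),g(x))$, and $\mathcal{H}(M)$ carries the subspace topology). For a continuous map $f\colon M\to M$ and $\delta>0$, a sequence $(x_i)_{i\ge0}$ in $M$ is a $\delta$-pseudo orbit of $f$ if $d(f(x_i),x_{i+1})\le\delta$ for all $i\ge0$; for $\epsilon>0$, it is $\epsilon$-shadowed by $x\in M$ if $d(f^i(x),x_i)\le\epsilon$ for all $i\ge0$. The map $f$ is chain continuous at $x\in M$ if for every $\epsilon>0$ there is $\delta>0$ such that every $\delta$-pseudo orbit $(x_i)_{i\ge0}$ of $f$ with $x_0=x$ is $\epsilon$-shadowed by $x$. $CC(f)$ denotes the set of points at which $f$ is chain continuous, and $f$ is almost chain continuous if $CC(f)$ is a dense $G_\delta$-subset of $M$. *)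

theory Defs
  imports "HOL-Analysis.Analysis" "HOL-Library.Extended_Nat"
begin

section \<open>Differentiable manifolds\<close>

text \<open>
  The library's \<open>Euclidean_space n\<close> models \<open>R^n\<close> as the sequences that vanish from index \<open>n\<close> on,
  so \<open>n\<close> is a term and dimension 0 is included.  A real function on an open subset \<open>W\<close> of it is
  of class \<open>C^k\<close> iff it is continuous and, for \<open>k > 0\<close>, all first-order partial derivatives exist
  on \<open>W\<close> and are of class \<open>C^(k-1)\<close>.  The predicate is only meant for open \<open>W\<close>.
\<close>

primrec Ck_on :: "nat \<Rightarrow> nat \<Rightarrow> (nat \<Rightarrow> real) set \<Rightarrow> ((nat \<Rightarrow> real) \<Rightarrow> real) \<Rightarrow> bool" where
  "Ck_on n 0 W f \<longleftrightarrow> continuous_map (subtopology (Euclidean_space n) W) euclideanreal f"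
| "Ck_on n (Suc k) W f \<longleftrightarrow>
     continuous_map (subtopology (Euclidean_space n) W) euclideanreal f \<and>
     (\<forall>i<n. \<exists>g. (\<forall>x\<in>W. ((\<lambda>t. f (x(i := t))) has_real_derivative g x) (at (x i))) \<and> Ck_on n k W g)"

definition Cr_map_on ::
  "nat \<Rightarrow> enat \<Rightarrow> (nat \<Rightarrow> real) set \<Rightarrow> ((nat \<Rightarrow> real) \<Rightarrow> nat \<Rightarrow> real) \<Rightarrow> bool" where
  "Cr_map_on n r W F \<longleftrightarrow> (\<forall>k. enat k \<le> r \<longrightarrow> (\<forall>j<n. Ck_on n k W (\<lambda>x. F x j)))"

definition chart :: "nat \<Rightarrow> 'a topology \<Rightarrow> 'a set \<times> ('a \<Rightarrow> nat \<Rightarrow> real) \<Rightarrow> bool" where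
  "chart n X = (\<lambda>(U, \<phi>). openin X U \<and> openin (Euclidean_space n) (\<phi> ` U) \<and>
     homeomorphic_map (subtopology X U) (subtopology (Euclidean_space n) (\<phi> ` U)) \<phi>)"

definition Cr_atlas ::
  "nat \<Rightarrow> enat \<Rightarrow> 'a topology \<Rightarrow> ('a set \<times> ('a \<Rightarrow> nat \<Rightarrow> real)) set \<Rightarrow> bool" where
  "Cr_atlas n r X \<A> \<longleftrightarrow>
     (\<forall>c\<in>\<A>. chart n X c) \<and>
     topspace X = (\<Union>c\<in>\<A>. fst c) \<and>
     (\<forall>(U, \<phi>)\<in>\<A>. \<forall>(V, \<psi>)\<in>\<A>. Cr_map_on n r (\<phi> ` (U \<inter> V)) (\<psi> \<circ> inv_into U \<phi>))"

text \<open>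
  A closed manifold of class \<open>C^r\<close>; \<open>r = \<infinity>\<close> is the smooth case.  There is no boundary because
  charts map onto open subsets of \<open>R^n\<close>.
\<close>

definition closed_Cr_manifold ::
  "nat \<Rightarrow> enat \<Rightarrow> 'a topology \<Rightarrow> ('a set \<times> ('a \<Rightarrow> nat \<Rightarrow> real)) set \<Rightarrow> bool" where
  "closed_Cr_manifold n r X \<A> \<longleftrightarrow>
     Hausdorff_space X \<and> second_countable X \<and> compact_space X \<and> Cr_atlas n r X \<A>"


section \<open>Spaces of maps and genericity\<close>

text \<open>
  \<open>cfunspace X m\<close> consists of the continuous maps from \<open>X\<close> to \<open>m\<close> with bounded image, under
  the supremum metric; boundedness is automatic for compact \<open>m\<close>.  Its elements are extensional
  (\<open>undefined\<close> outside \<open>X\<close>), so each map on the carrier is represented exactly once.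
\<close>

definition cmap_space :: "'a metric \<Rightarrow> ('a \<Rightarrow> 'a) topology" where
  "cmap_space m = mtopology_of (cfunspace (mtopology_of m) m)"

definition homeo_space :: "'a metric \<Rightarrow> ('a \<Rightarrow> 'a) topology" where
  "homeo_space m =
     subtopology (cmap_space m) {f. homeomorphic_map (mtopology_of m) (mtopology_of m) f}"

definition generic_in :: "'b topology \<Rightarrow> ('b \<Rightarrow> bool) \<Rightarrow> bool" where
  "generic_in T P \<longleftrightarrow>
     (\<exists>\<U> :: nat \<Rightarrow> 'b set. (\<forall>k. openin T (\<U> k) \<and> T closure_of (\<U> k) = topspace T) \<and>
        (\<Inter>k. \<U> k) \<subseteq> {f \<in> topspace T. P f})"


section \<open>Chain continuity\<close>

definition pseudo_orbit :: "'a metric \<Rightarrow> ('a \<Rightarrow> 'a) \<Rightarrow> real \<Rightarrow> (nat \<Rightarrow> 'a) \<Rightarrow> bool" where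
  "pseudo_orbit m f \<delta> x \<longleftrightarrow>
     (\<forall>i. x i \<in> mspace m) \<and> (\<forall>i. mdist m (f (x i)) (x (Suc i)) \<le> \<delta>)"

definition shadowed_by :: "'a metric \<Rightarrow> ('a \<Rightarrow> 'a) \<Rightarrow> real \<Rightarrow> (nat \<Rightarrow> 'a) \<Rightarrow> 'a \<Rightarrow> bool" where
  "shadowed_by m f \<epsilon> x y \<longleftrightarrow> (\<forall>i. mdist m ((f ^^ i) y) (x i) \<le> \<epsilon>)"

definition chain_continuous_at :: "'a metric \<Rightarrow> ('a \<Rightarrow> 'a) \<Rightarrow> 'a \<Rightarrow> bool" where
  "chain_continuous_at m f p \<longleftrightarrow>
     (\<forall>\<epsilon>>0. \<exists>\<delta>>0. \<forall>x. pseudo_orbit m f \<delta> x \<and> x 0 = p \<longrightarrow> shadowed_by m f \<epsilon> x p)"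

definition CC :: "'a metric \<Rightarrow> ('a \<Rightarrow> 'a) \<Rightarrow> 'a set" where
  "CC m f = {p \<in> mspace m. chain_continuous_at m f p}"

definition almost_chain_continuous :: "'a metric \<Rightarrow> ('a \<Rightarrow> 'a) \<Rightarrow> bool" where
  "almost_chain_continuous m f \<longleftrightarrow>
     gdelta_in (mtopology_of m) (CC m f) \<and> mtopology_of m closure_of CC m f = mspace m"

end

theory Submission
  imports Defs
begin

text \<open>
  Call a point stable at scale \<open>\<epsilon>\<close> for \<open>f\<close> if, for some \<open>\<delta> > 0\<close>, any two \<open>\<delta>\<close>-pseudo orbits that
  start close to it stay within \<open>\<epsilon>\<close> of each other forever (\<open>chain_stable_set\<close>).  These points form
  an open set, and \<open>CC f\<close> is the intersection of these sets over the scales \<open>1/(k+1)\<close>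
  (\<open>CC_eq_Inter_chain_stable_set\<close>).  So \<open>CC f\<close> is, for continuous \<open>f\<close>, a \<open>G\<^sub>\<delta>\<close> set, and by Baire's theorem it is
  dense as soon as at every scale the stable points are dense.

  This is a countable family of conditions on \<open>f\<close>: at the scale \<open>1/(k+1)\<close>, the nonempty set \<open>B\<close> of a countable
  base contains a stable point.  Each condition is open in the uniform topology
  (\<open>chain_stable_set_persists\<close>).  The heart of the matter is that each is dense, and here one
  perturbation serves homeomorphisms and continuous maps at once: \<open>f\<close> is replaced by \<open>h \<circ> f\<close> with a
  homeomorphism \<open>h\<close> close to the identity (\<open>closing_perturbation\<close>).  By compactness, the orbit of a
  given point \<open>p \<in> B\<close> contains a point \<open>z\<close> that later returns to a small cell around \<open>z\<close>.  Let \<open>h\<close>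
  be supported in this cell and contract most of it into a tiny ball around \<open>z\<close>.  Then the ball
  returns into its own interior after finitely many steps, and the orbits that start near \<open>p\<close>
  fall into it when they first enter the cell.  A ball that is mapped well inside itself also holds
  pseudo orbits with small jumps, so \<open>p\<close> has become stable (\<open>trapped_in_chain_stable_set\<close>).

  Charts are used only to produce the cells and their contractions
  (\<open>closed_manifold_small_cells\<close>), from a radial contraction of balls in \<open>R^n\<close>.  The
  sum metric \<open>l1_dist\<close> is used there, since the argument needs a norm but no inner product.
\<close>

section \<open>The sum metric on Euclidean space\<close>

definition l1_dist :: "nat \<Rightarrow> (nat \<Rightarrow> real) \<Rightarrow> (nat \<Rightarrow> real) \<Rightarrow> real" where
  "l1_dist n x y = (\<Sum>i<n. \<bar>x i - y i\<bar>)"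

lemma l1_dist_nonneg [simp]: "0 \<le> l1_dist n x y"
  by (simp add: l1_dist_def sum_nonneg)

lemma l1_dist_self [simp]: "l1_dist n x x = 0"
  by (simp add: l1_dist_def)

lemma l1_dist_commute: "l1_dist n x y = l1_dist n y x"
  by (simp add: l1_dist_def abs_minus_commute)

lemma l1_dist_triangle: "l1_dist n x z \<le> l1_dist n x y + l1_dist n y z"
  unfolding l1_dist_def sum.distrib[symmetric] by (intro sum_mono) linarith

lemma l1_dist_eq_0:
  assumes "x \<in> topspace (Euclidean_space n)" "y \<in> topspace (Euclidean_space n)"
  shows "l1_dist n x y = 0 \<longleftrightarrow> x = y"
proof
  assume "l1_dist n x y = 0"
  then have "x i = y i" if "i < n" for i
    using that by (simp add: l1_dist_def sum_nonneg_eq_0_iff)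
  moreover have "x i = y i" if "\<not> i < n" for i
    using assms that by (simp add: topspace_Euclidean_space)
  ultimately show "x = y" by blast
qed simp

lemma l1_dist_homothety:
  assumes "0 \<le> a"
  shows "l1_dist n (\<lambda>i. c i + a * (x i - c i)) c = a * l1_dist n x c"
proof -
  have "\<bar>(c i + a * (x i - c i)) - c i\<bar> = a * \<bar>x i - c i\<bar>" for i
    using assms by (simp add: abs_mult)
  then show ?thesis
    by (simp add: l1_dist_def sum_distrib_left)
qed

lemma continuous_on_l1_dist [continuous_intros]: "continuous_on S (\<lambda>x. l1_dist n x c)"
  unfolding l1_dist_def
  by (intro continuous_intros continuous_on_subset[OF continuous_on_product_coordinates]) auto

lemma Euclidean_space_eq_top_of_set:
  "Euclidean_space n = top_of_set (topspace (Euclidean_space n))"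
  by (metis Euclidean_space_def euclidean_product_topology topspace_Euclidean_space)

lemma openin_Euclidean_space_l1_ball:
  assumes "openin (Euclidean_space n) W" "x \<in> W"
  obtains e where "e > 0"
    "\<And>y. y \<in> topspace (Euclidean_space n) \<Longrightarrow> l1_dist n y x < e \<Longrightarrow> y \<in> W"
proof -
  obtain T where T: "openin (powertop_real UNIV) T" "W = T \<inter> {x. \<forall>i\<ge>n. x i = 0}"
    using assms(1) unfolding Euclidean_space_def openin_subtopology by blast
  obtain Z where Z: "x \<in> (\<Pi>\<^sub>E i\<in>UNIV. Z i)" "\<And>i. openin euclideanreal (Z i)"
      "(\<Pi>\<^sub>E i\<in>UNIV. Z i) \<subseteq> T"
    using product_topology_open_contains_basis[OF T(1)] assms(2) T(2) by (metis IntD1)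
  have "\<exists>e>0. \<forall>t. \<bar>t - x i\<bar> < e \<longrightarrow> t \<in> Z i" for i
  proof -
    have "open (Z i)" "x i \<in> Z i"
      using Z(1) Z(2)[of i] by (auto simp: PiE_iff)
    then show ?thesis
      unfolding open_dist by (metis dist_real_def)
  qed
  then obtain e where e: "\<And>i. e i > 0" "\<And>i t. \<bar>t - x i\<bar> < e i \<Longrightarrow> t \<in> Z i"
    by metis
  define e0 where "e0 = Min (insert 1 (e ` {..<n}))"
  have e0: "e0 > 0" "\<And>i. i < n \<Longrightarrow> e0 \<le> e i"
    using e(1) by (auto simp: e0_def)
  show thesis
  proof (rule that[OF e0(1)])
    fix y assume y: "y \<in> topspace (Euclidean_space n)" "l1_dist n y x < e0"
    have "y i \<in> Z i" for i
    proof (cases "i < n")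
      case True
      have "\<bar>y i - x i\<bar> \<le> l1_dist n y x"
        unfolding l1_dist_def using True by (intro member_le_sum) auto
      then show ?thesis
        using e(2)[of "y i" i] e0(2)[OF True] y(2) by linarith
    next
      case False
      then have "y i = x i"
        using y(1) assms(2) T(2) by (simp add: topspace_Euclidean_space)
      then show ?thesis using e by simp
    qed
    then show "y \<in> W"
      using Z(3) T(2) y(1) by (auto simp: topspace_Euclidean_space)
  qed
qed

lemma compactin_l1_cball:
  "compactin (Euclidean_space n) {x \<in> topspace (Euclidean_space n). l1_dist n x c \<le> R}"
proof -
  define box where "box = (\<Pi>\<^sub>E i\<in>(UNIV::nat set). if i < n then {c i - R..c i + R} else {0})"
  have "compactin (powertop_real UNIV) box"
    unfolding box_def by (subst compactin_PiE) auto
  then have "compact box"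
    by (simp add: euclidean_product_topology)
  moreover have "closed {x. l1_dist n x c \<le> R}"
    by (intro closed_Collect_le continuous_intros)
  ultimately have "compact (box \<inter> {x. l1_dist n x c \<le> R})"
    by (rule compact_Int_closed)
  moreover have "box \<inter> {x. l1_dist n x c \<le> R}
      = {x \<in> topspace (Euclidean_space n). l1_dist n x c \<le> R}"
  proof -
    have "x i \<in> {c i - R..c i + R}" if "l1_dist n x c \<le> R" "i < n" for x i
    proof -
      have "\<bar>x i - c i\<bar> \<le> l1_dist n x c"
        unfolding l1_dist_def using that by (intro member_le_sum) auto
      with that show ?thesis by (auto simp: abs_le_iff)
    qed
    then show ?thesis
      by (auto simp: box_def PiE_iff topspace_Euclidean_space not_less split: if_splits)
  qed
  ultimately have "compact {x \<in> topspace (Euclidean_space n). l1_dist n x c \<le> R}"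
    by simp
  then show ?thesis
    by (subst Euclidean_space_eq_top_of_set) (auto simp: compactin_subtopology)
qed

section \<open>Contracting a ball towards its centre\<close>

text \<open>
  Up to the radius \<open>R\<close> around \<open>c\<close>, a vector of length \<open>u\<close> gets the length \<open>R * (u / R)^(k + 1)\<close>;
  beyond \<open>R\<close> the map is the identity.  A power profile needs a single formula, is a bijection for
  every \<open>k\<close>, and pushes each smaller ball as close to the centre as desired when \<open>k\<close> grows.
\<close>

definition radial :: "nat \<Rightarrow> (nat \<Rightarrow> real) \<Rightarrow> real \<Rightarrow> nat \<Rightarrow> (nat \<Rightarrow> real) \<Rightarrow> nat \<Rightarrow> real" where
  "radial n c R k x = (\<lambda>i. c i + (min 1 (l1_dist n x c / R)) ^ k * (x i - c i))"

context
  fixes n :: nat and c :: "nat \<Rightarrow> real" and R :: real and k :: nat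
  assumes c: "c \<in> topspace (Euclidean_space n)" and R: "R > 0"
begin

lemma radial_in_Euclidean_space:
  "x \<in> topspace (Euclidean_space n) \<Longrightarrow> radial n c R k x \<in> topspace (Euclidean_space n)"
  using c by (simp add: topspace_Euclidean_space radial_def)

lemma l1_dist_radial:
  "l1_dist n (radial n c R k x) c = (min 1 (l1_dist n x c / R)) ^ k * l1_dist n x c"
  using R by (simp add: radial_def l1_dist_homothety)

lemma l1_dist_radial_le: "l1_dist n (radial n c R k x) c \<le> l1_dist n x c"
proof -
  have "(min 1 (l1_dist n x c / R)) ^ k \<le> 1"
    using R by (intro power_le_one) auto
  then show ?thesis
    unfolding l1_dist_radial by (intro mult_left_le_one_le) (use R in auto)
qed

lemma radial_outside: "l1_dist n x c \<ge> R \<Longrightarrow> radial n c R k x = x"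
  using R by (simp add: radial_def)

lemma continuous_map_radial:
  "continuous_map (Euclidean_space n) (Euclidean_space n) (radial n c R k)"
proof -
  have "continuous_on UNIV (radial n c R k)"
    unfolding radial_def using R
    by (intro continuous_on_coordinatewise_then_product continuous_intros
          continuous_on_product_coordinates) auto
  then have "continuous_on (topspace (Euclidean_space n)) (radial n c R k)"
    using continuous_on_subset by blast
  then show ?thesis
    using cm_Euclidean_space_iff_continuous_on[of n UNIV n "radial n c R k"]
      radial_in_Euclidean_space by auto
qed

lemma radial_profile_strict_mono:
  assumes "0 \<le> u" "u < v"
  shows "(min 1 (u / R)) ^ k * u < (min 1 (v / R)) ^ k * v"
proof -
  have "min 1 (u / R) \<le> min 1 (v / R)"
    using assms R by (auto simp: min_def divide_right_mono field_simps)
  then have "(min 1 (u / R)) ^ k \<le> (min 1 (v / R)) ^ k"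
    using assms R by (intro power_mono) auto
  moreover have "(min 1 (v / R)) ^ k > 0"
    using assms R by (intro zero_less_power) (simp add: min_def)
  ultimately show ?thesis
    using assms by (metis mult_left_mono mult_right_mono mult_strict_left_mono order_le_less_trans)
qed

lemma inj_on_radial: "inj_on (radial n c R k) (topspace (Euclidean_space n))"
proof (rule inj_onI)
  fix x y
  assume x: "x \<in> topspace (Euclidean_space n)" and y: "y \<in> topspace (Euclidean_space n)"
    and eq: "radial n c R k x = radial n c R k y"
  have "(min 1 (l1_dist n x c / R)) ^ k * l1_dist n x c
      = (min 1 (l1_dist n y c / R)) ^ k * l1_dist n y c"
    using eq l1_dist_radial by metis
  then have d: "l1_dist n x c = l1_dist n y c"
    using radial_profile_strict_mono[of "l1_dist n x c" "l1_dist n y c"]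
      radial_profile_strict_mono[of "l1_dist n y c" "l1_dist n x c"]
    by (metis l1_dist_nonneg linorder_neq_iff order_less_irrefl)
  show "x = y"
  proof (cases "l1_dist n x c = 0")
    case True
    then show ?thesis
      using d x y c l1_dist_eq_0 by metis
  next
    case False
    then have pos: "(min 1 (l1_dist n x c / R)) ^ k > 0"
      using R l1_dist_nonneg[of n x c] by (intro zero_less_power) (simp add: less_le min_def)
    show ?thesis
    proof
      fix i
      have "(min 1 (l1_dist n x c / R)) ^ k * (x i - c i)
          = (min 1 (l1_dist n x c / R)) ^ k * (y i - c i)"
        using fun_cong[OF eq, of i] d by (simp add: radial_def)
      then show "x i = y i"
        using pos by (metis diff_add_cancel less_irrefl mult_cancel_left)
    qed
  qed
qed

lemma radial_surj:
  assumes y: "y \<in> topspace (Euclidean_space n)" and "l1_dist n y c \<le> R"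
  obtains x where "x \<in> topspace (Euclidean_space n)" "l1_dist n x c \<le> R" "radial n c R k x = y"
proof (cases "y = c")
  case True
  then show ?thesis
    using that[of c] c R by (simp add: radial_def)
next
  case False
  define v where "v = l1_dist n y c"
  have v: "v > 0" "v \<le> R"
    using False l1_dist_eq_0[OF y c] assms(2) l1_dist_nonneg[of n y c] by (auto simp: v_def less_le)
  have "\<exists>u\<ge>0. u \<le> R \<and> (min 1 (u / R)) ^ k * u = v"
    by (rule IVT') (use v R in \<open>auto intro!: continuous_intros\<close>)
  then obtain u where u: "0 \<le> u" "u \<le> R" "(min 1 (u / R)) ^ k * u = v" by blast
  define x where "x = (\<lambda>i. c i + u / v * (y i - c i))"
  have "l1_dist n x c = u / v * l1_dist n y c"
    using u v by (simp only: x_def, subst l1_dist_homothety) auto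
  then have d: "l1_dist n x c = u"
    using v by (simp add: v_def)
  show ?thesis
  proof (rule that)
    show "x \<in> topspace (Euclidean_space n)"
      using c y by (simp add: x_def topspace_Euclidean_space)
    show "l1_dist n x c \<le> R"
      using d u by simp
    have "(min 1 (u / R)) ^ k * (u / v * (y i - c i)) = y i - c i" for i
    proof -
      have "(min 1 (u / R)) ^ k * (u / v * (y i - c i)) = ((min 1 (u / R)) ^ k * u) / v * (y i - c i)"
        by simp
      then show ?thesis using u(3) v by simp
    qed
    then show "radial n c R k x = y"
      by (intro ext) (simp add: radial_def d, simp add: x_def)
  qed
qed

end

lemma radial_squeeze:
  assumes "0 \<le> t" "t < R" "0 < s"
  obtains k where "\<And>n c x. l1_dist n x c \<le> t \<Longrightarrow> l1_dist n (radial n c R k x) c < s"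
proof -
  have "R > 0" using assms by simp
  have "(\<lambda>k. (t / R) ^ k * R) \<longlonglongrightarrow> 0 * R"
    using assms by (intro tendsto_mult LIMSEQ_power_zero tendsto_const) auto
  then have "\<forall>\<^sub>F k in sequentially. (t / R) ^ k * R < s"
    using assms(3) by (simp add: order_tendstoD)
  then obtain k where k: "(t / R) ^ k * R < s"
    using eventually_sequentially by auto
  show thesis
  proof (rule that)
    fix n c x assume x: "l1_dist n x c \<le> t"
    have "(min 1 (l1_dist n x c / R)) ^ k \<le> (t / R) ^ k"
      using x assms by (intro power_mono) (auto simp: min_def divide_right_mono field_simps)
    then have "(min 1 (l1_dist n x c / R)) ^ k * l1_dist n x c \<le> (t / R) ^ k * R"
      using x assms by (intro mult_mono) auto
    then show "l1_dist n (radial n c R k x) c < s"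
      using k \<open>R > 0\<close> by (simp add: radial_def l1_dist_homothety)
  qed
qed

section \<open>Cells in a manifold\<close>

text \<open>
  The only property of manifolds that the dynamics needs: \<open>V\<close> behaves like a ball with centre \<open>z\<close>.
  The order of the quantifiers matters.  The support \<open>C\<close> and the neighbourhood \<open>P\<close> of \<open>F\<close> depend on
  \<open>F\<close> only, so that the target \<open>D\<close> of the squeezing can be chosen small in terms of how the
  dynamics moves points near \<open>z\<close> relative to \<open>C\<close> and \<open>P\<close>.
\<close>

definition cell :: "'a topology \<Rightarrow> 'a set \<Rightarrow> 'a \<Rightarrow> bool" where
  "cell X V z \<longleftrightarrow> openin X V \<and> z \<in> V \<and>
     (\<forall>F. finite F \<and> F \<subseteq> V \<longrightarrow>
       (\<exists>C P. closedin X C \<and> C \<subseteq> V \<and> openin X P \<and> F \<subseteq> P \<and>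
         (\<forall>D. openin X D \<and> z \<in> D \<longrightarrow>
           (\<exists>h. homeomorphic_map X X h \<and> (\<forall>y\<in>topspace X - C. h y = y) \<and>
                h ` C \<subseteq> C \<and> h ` P \<subseteq> D))))"

text \<open>
  The neighbourhood \<open>N\<close> is chosen before the centre \<open>z\<close>: if an orbit visits \<open>N\<close> twice, the first of
  the two points can serve as the centre of a cell, and the second is still in that cell.
\<close>

definition small_cells :: "'a topology \<Rightarrow> bool" where
  "small_cells X \<longleftrightarrow> (\<forall>Q w. openin X Q \<and> w \<in> Q \<longrightarrow>
     (\<exists>N. openin X N \<and> w \<in> N \<and> (\<forall>z\<in>N. \<exists>V. N \<subseteq> V \<and> V \<subseteq> Q \<and> cell X V z)))"

text \<open>
  The radial contraction is transported by the chart and extended by the identity.  Both pieces are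
  continuous on open sets that cover \<open>X\<close>, because the support is compact and hence closed; and a
  continuous bijection of a compact Hausdorff space is a homeomorphism, so the inverse need not be
  examined.
\<close>

lemma chart_ball_is_cell:
  assumes X: "compact_space X" "Hausdorff_space X"
    and U: "openin X U" and W: "openin (Euclidean_space n) W"
    and hom: "homeomorphic_maps (subtopology X U) (subtopology (Euclidean_space n) W) \<phi> \<psi>"
    and z: "z \<in> U" and "S > 0"
    and ball: "{x \<in> topspace (Euclidean_space n). l1_dist n x (\<phi> z) < S} \<subseteq> W"
  shows "cell X {y \<in> U. l1_dist n (\<phi> y) (\<phi> z) < S} z"
proof -
  define E where "E = Euclidean_space n"
  define c where "c = \<phi> z"
  define V where "V = {y \<in> U. l1_dist n (\<phi> y) c < S}"
  note E = W[folded E_def] hom[folded E_def] ball[folded E_def c_def]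
  have UX: "U \<subseteq> topspace X" and WE: "W \<subseteq> topspace E"
    using U E(1) by (auto dest: openin_subset)
  have contphi: "continuous_map (subtopology X U) (subtopology E W) \<phi>"
    and contpsi: "continuous_map (subtopology E W) (subtopology X U) \<psi>"
    using E(2) by (auto simp: homeomorphic_maps_def)
  have phi: "\<phi> y \<in> W" "\<psi> (\<phi> y) = y" if "y \<in> U" for y
    using that E(2) UX WE by (auto simp: homeomorphic_maps_def continuous_map_def Pi_iff)
  have psi: "\<psi> x \<in> U" "\<phi> (\<psi> x) = x" if "x \<in> W" for x
    using that E(2) UX WE by (auto simp: homeomorphic_maps_def continuous_map_def Pi_iff)
  have cE: "c \<in> topspace E"
    using phi(1)[OF z] WE by (auto simp: c_def)
  have contd: "continuous_map (subtopology X U) euclideanreal (\<lambda>y. l1_dist n (\<phi> y) c)"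
  proof -
    have "continuous_map E euclideanreal (\<lambda>x. l1_dist n x c)"
      unfolding E_def by (subst Euclidean_space_eq_top_of_set) (simp add: continuous_on_l1_dist)
    then have "continuous_map (subtopology E W) euclideanreal (\<lambda>x. l1_dist n x c)"
      by (rule continuous_map_from_subtopology)
    from continuous_map_compose[OF contphi this] show ?thesis
      by (simp add: o_def)
  qed
  have openU: "openin X {y \<in> U. l1_dist n (\<phi> y) c < s}" for s
  proof -
    have "openin (subtopology X U) {y \<in> topspace (subtopology X U). l1_dist n (\<phi> y) c \<in> {..<s}}"
      by (rule openin_continuous_map_preimage[OF contd]) auto
    moreover have "{y \<in> topspace (subtopology X U). l1_dist n (\<phi> y) c \<in> {..<s}}
        = {y \<in> U. l1_dist n (\<phi> y) c < s}"
      using UX by auto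
    ultimately show ?thesis
      using U openin_open_subtopology by metis
  qed
  have VX: "openin X V" "V \<subseteq> U" "z \<in> V"
    using openU[of S] z \<open>S > 0\<close> by (auto simp: V_def c_def)
  have "\<exists>C P. closedin X C \<and> C \<subseteq> V \<and> openin X P \<and> F \<subseteq> P \<and>
         (\<forall>D. openin X D \<and> z \<in> D \<longrightarrow>
           (\<exists>h. homeomorphic_map X X h \<and> (\<forall>y\<in>topspace X - C. h y = y) \<and>
                h ` C \<subseteq> C \<and> h ` P \<subseteq> D))"
    if F: "finite F" "F \<subseteq> V" for F
  proof -
    define t where "t = Max (insert 0 ((\<lambda>y. l1_dist n (\<phi> y) c) ` F))"
    have t: "0 \<le> t" "t < S" "\<And>y. y \<in> F \<Longrightarrow> l1_dist n (\<phi> y) c \<le> t"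
      using F \<open>S > 0\<close> by (auto simp: t_def V_def)
    (* F lies in the ball of radius t.  The slack t < t1 gives an open set P around F, and R < S
       gives a closed support C inside V. *)
    define t1 where "t1 = (2 * t + S) / 3"
    define R where "R = (t + 2 * S) / 3"
    have tR: "t < t1" "0 \<le> t1" "t1 < R" "R < S" "0 < R"
      using t by (auto simp: t1_def R_def)
    define P where "P = {y \<in> U. l1_dist n (\<phi> y) c < t1}"
    define C where "C = {y \<in> U. l1_dist n (\<phi> y) c \<le> R}"
    have "closedin X C"
    proof -
      have sub: "{x \<in> topspace E. l1_dist n x c \<le> R} \<subseteq> W"
        using E(3) tR by auto
      then have "compactin (subtopology E W) {x \<in> topspace E. l1_dist n x c \<le> R}"
        using compactin_l1_cball by (simp add: compactin_subtopology E_def)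
      then have "compactin (subtopology X U) (\<psi> ` {x \<in> topspace E. l1_dist n x c \<le> R})"
        using contpsi image_compactin by blast
      moreover have "\<psi> ` {x \<in> topspace E. l1_dist n x c \<le> R} = C"
      proof (intro equalityI subsetI)
        fix y assume y: "y \<in> C"
        then have "\<phi> y \<in> {x \<in> topspace E. l1_dist n x c \<le> R}" "\<psi> (\<phi> y) = y"
          using phi[of y] WE by (auto simp: C_def)
        then show "y \<in> \<psi> ` {x \<in> topspace E. l1_dist n x c \<le> R}"
          by (metis image_eqI)
      qed (use sub psi in \<open>auto simp: C_def\<close>)
      ultimately show ?thesis
        using X(2) by (simp add: compactin_subtopology compactin_imp_closedin)
    qed
    moreover have "C \<subseteq> V" "openin X P" "F \<subseteq> P"
      using tR t(3) F openU[of t1] VX by (force simp: C_def V_def P_def)+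
    moreover have "\<exists>h. homeomorphic_map X X h \<and> (\<forall>y\<in>topspace X - C. h y = y) \<and>
                h ` C \<subseteq> C \<and> h ` P \<subseteq> D" if D: "openin X D" "z \<in> D" for D
    proof -
      have "openin (subtopology E W) {x \<in> topspace (subtopology E W). \<psi> x \<in> U \<inter> D}"
        using openin_continuous_map_preimage[OF contpsi] D(1) openin_subtopology_Int2 by metis
      then have "openin E {x \<in> topspace (subtopology E W). \<psi> x \<in> U \<inter> D}"
        using E(1) openin_open_subtopology by metis
      moreover have "c \<in> {x \<in> topspace (subtopology E W). \<psi> x \<in> U \<inter> D}"
        using phi[OF z] z D(2) WE by (auto simp: c_def)
      ultimately obtain s where s: "s > 0"
        "\<And>x. x \<in> topspace E \<Longrightarrow> l1_dist n x c < s \<Longrightarrow> \<psi> x \<in> D"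
        unfolding E_def by (rule openin_Euclidean_space_l1_ball) auto
      obtain k where k: "\<And>x. l1_dist n x c \<le> t1 \<Longrightarrow> l1_dist n (radial n c R k x) c < s"
        using radial_squeeze[OF tR(2,3) s(1)] by metis
      define f where "f = radial n c R k"
      note rc = cE[unfolded E_def] tR(5)
      have f: "f x \<in> topspace E" "l1_dist n (f x) c \<le> l1_dist n x c" if "x \<in> topspace E" for x
        using that radial_in_Euclidean_space[OF rc] l1_dist_radial_le[OF rc]
        by (auto simp: f_def E_def)
      have fW: "f (\<phi> y) \<in> W" if "y \<in> V" for y
        using that f[of "\<phi> y"] phi[of y] WE E(3) by (force simp: V_def)
      define h where "h y = (if y \<in> V then \<psi> (f (\<phi> y)) else y)" for y
      have hout: "h y = y" if "y \<notin> C" for y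
        using that radial_outside[OF rc, of "\<phi> y" k] phi[of y]
        by (auto simp: h_def f_def C_def V_def)
      have hV: "h y \<in> V" "\<phi> (h y) = f (\<phi> y)" "l1_dist n (\<phi> (h y)) c \<le> l1_dist n (\<phi> y) c"
        if "y \<in> V" for y
        using that fW[OF that] psi f[of "\<phi> y"] phi[of y] WE by (force simp: h_def V_def)+
      have "continuous_map X X h"
      proof (rule pasting_lemma[where I = UNIV and T = "\<lambda>b. if b then V else topspace X - C"
              and f = "\<lambda>b. if b then \<psi> \<circ> f \<circ> \<phi> else id"])
        fix b :: bool
        have "continuous_map (subtopology X V) (subtopology E W) (f \<circ> \<phi>)"
        proof -
          have "continuous_map (subtopology X V) E \<phi>"
            using contphi VX(2) continuous_map_from_subtopology_mono
            by (metis continuous_map_into_fulltopology)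
          then have "continuous_map (subtopology X V) E (f \<circ> \<phi>)"
            using continuous_map_compose continuous_map_radial[OF rc] by (metis E_def f_def)
          then show ?thesis
            using fW by (auto simp: continuous_map_in_subtopology)
        qed
        then have "continuous_map (subtopology X V) X (\<psi> \<circ> (f \<circ> \<phi>))"
          using contpsi continuous_map_compose continuous_map_into_fulltopology by metis
        then show "continuous_map (subtopology X (if b then V else topspace X - C)) X
            (if b then \<psi> \<circ> f \<circ> \<phi> else id)"
          by (auto simp: o_assoc)
        show "openin X (if b then V else topspace X - C)"
          using VX \<open>closedin X C\<close> by auto
      next
        fix b1 b2 :: bool and x
        assume x: "x \<in> topspace X \<inter> (if b1 then V else topspace X - C)
            \<inter> (if b2 then V else topspace X - C)"
        have "\<psi> (f (\<phi> y)) = y" if "y \<in> V" "y \<notin> C" for y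
          using hout[OF that(2)] that(1) by (simp add: h_def)
        then show "(if b1 then \<psi> \<circ> f \<circ> \<phi> else id) x = (if b2 then \<psi> \<circ> f \<circ> \<phi> else id) x"
          using x by (auto split: if_splits)
      next
        fix x assume "x \<in> topspace X"
        then show "\<exists>j. j \<in> UNIV \<and> x \<in> (if j then V else topspace X - C)
            \<and> h x = (if j then \<psi> \<circ> f \<circ> \<phi> else id) x"
          using \<open>C \<subseteq> V\<close> by (cases "x \<in> V") (auto simp: h_def intro: exI[of _ True] exI[of _ False])
      qed
      moreover have "inj_on h (topspace X)"
      proof (rule inj_onI)
        fix x y assume xy: "x \<in> topspace X" "y \<in> topspace X" "h x = h y"
        show "x = y"
        proof (cases "x \<in> V \<and> y \<in> V")
          case True
          then have "f (\<phi> x) = f (\<phi> y)"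
            using hV(2) xy(3) by metis
          then have "\<phi> x = \<phi> y"
            using inj_onD[OF inj_on_radial[OF rc, of k], of "\<phi> x" "\<phi> y"] True
              phi(1)[of x] phi(1)[of y] VX(2) WE
            unfolding f_def E_def by blast
          then show ?thesis
            using True phi(2) VX(2) by (metis subsetD)
        next
          case False
          then show ?thesis
            using hV(1) xy(3) by (metis h_def)
        qed
      qed
      moreover have "h ` topspace X = topspace X"
      proof (intro equalityI subsetI)
        fix y assume "y \<in> h ` topspace X"
        then show "y \<in> topspace X"
          using hV(1) VX(2) UX by (metis h_def imageE subsetD)
      next
        fix y assume y: "y \<in> topspace X"
        show "y \<in> h ` topspace X"
        proof (cases "y \<in> C")
          case True
          then have "\<phi> y \<in> topspace (Euclidean_space n)" "l1_dist n (\<phi> y) c \<le> R"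
            using phi[of y] WE by (auto simp: C_def E_def)
          from radial_surj[OF rc this] obtain x where
            x: "x \<in> topspace E" "l1_dist n x c \<le> R" "f x = \<phi> y"
            unfolding E_def f_def by metis
          then have "x \<in> W" using E(3) tR by auto
          then have "\<psi> x \<in> C" using psi x by (simp add: C_def)
          then have "h (\<psi> x) = y"
            using \<open>C \<subseteq> V\<close> psi(2)[OF \<open>x \<in> W\<close>] x phi(2)[of y] True by (auto simp: h_def C_def)
          then show ?thesis
            using \<open>\<psi> x \<in> C\<close> UX by (auto simp: C_def)
        next
          case False
          then show ?thesis using hout y by (metis image_eqI)
        qed
      qed
      ultimately have "homeomorphic_map X X h"
        using X continuous_imp_homeomorphic_map by blast
      moreover have "h ` C \<subseteq> C"
        using \<open>C \<subseteq> V\<close> hV VX(2) by (force simp: C_def)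
      moreover have "h ` P \<subseteq> D"
      proof
        fix u assume "u \<in> h ` P"
        then obtain y where y: "y \<in> P" "u = h y" by blast
        then have "y \<in> V" "l1_dist n (f (\<phi> y)) c < s"
          using tR k[of "\<phi> y"] by (auto simp: P_def V_def f_def)
        then show "u \<in> D"
          using s(2) fW WE y by (auto simp: h_def)
      qed
      ultimately show ?thesis
        using hout by blast
    qed
    ultimately show ?thesis by blast
  qed
  then show ?thesis
    using VX unfolding cell_def V_def c_def by blast
qed

text \<open>
  A chart ball of radius \<open>e\<close> around \<open>w\<close> contains the balls of radius \<open>e/2\<close> around all points at
  distance less than \<open>e/4\<close> from \<open>w\<close>, and each of these contains all those points.
\<close>

lemma closed_manifold_small_cells:
  assumes M: "closed_Cr_manifold n r X \<A>"
  shows "small_cells X"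
  unfolding small_cells_def
proof (intro allI impI, elim conjE)
  fix Q w assume O: "openin X Q" "w \<in> Q"
  have X: "compact_space X" "Hausdorff_space X"
    using M by (auto simp: closed_Cr_manifold_def)
  have "w \<in> topspace X" using O openin_subset by blast
  then obtain U \<phi> where U: "(U, \<phi>) \<in> \<A>" "w \<in> U"
    using M by (fastforce simp: closed_Cr_manifold_def Cr_atlas_def)
  define E where "E = Euclidean_space n"
  define W where "W = \<phi> ` U"
  have "chart n X (U, \<phi>)"
    using U M by (auto simp: closed_Cr_manifold_def Cr_atlas_def)
  then have ch: "openin X U" "openin E W"
      "homeomorphic_map (subtopology X U) (subtopology E W) \<phi>"
    by (auto simp: chart_def E_def W_def)
  then obtain \<psi> where hom: "homeomorphic_maps (subtopology X U) (subtopology E W) \<phi> \<psi>"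
    using homeomorphic_map_maps by blast
  have inj: "inj_on \<phi> U"
    using ch(3) openin_subset[OF ch(1)] homeomorphic_imp_injective_map[OF ch(3)]
    by (simp add: Int_absorb1)
  have WE: "W \<subseteq> topspace E" using ch(2) openin_subset by blast
  have "openin (subtopology X U) (U \<inter> Q)"
    using O(1) by (metis openin_subtopology_Int2)
  then have "openin (subtopology E W) (\<phi> ` (U \<inter> Q))"
    using homeomorphic_imp_open_map[OF ch(3)] by (simp add: open_map_def)
  then have "openin E (\<phi> ` (U \<inter> Q))"
    using ch(2) openin_open_subtopology by metis
  moreover have "\<phi> w \<in> \<phi> ` (U \<inter> Q)" using U O by blast
  ultimately obtain e where e: "e > 0"
    "\<And>y. y \<in> topspace E \<Longrightarrow> l1_dist n y (\<phi> w) < e \<Longrightarrow> y \<in> \<phi> ` (U \<inter> Q)"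
    unfolding E_def by (rule openin_Euclidean_space_l1_ball) auto
  define B where "B z s = {y \<in> U. l1_dist n (\<phi> y) (\<phi> z) < s}" for z s
  have cellB: "B z (e/2) \<subseteq> Q \<and> cell X (B z (e/2)) z" if "z \<in> B w (e/4)" for z
  proof -
    have zw: "z \<in> U" "l1_dist n (\<phi> z) (\<phi> w) < e/4" using that by (auto simp: B_def)
    have near: "l1_dist n y (\<phi> w) < e" if "l1_dist n y (\<phi> z) < e/2" for y
      using l1_dist_triangle[of n y "\<phi> w" "\<phi> z"] that zw e(1) by linarith
    have "B z (e/2) \<subseteq> Q"
    proof
      fix y assume y: "y \<in> B z (e/2)"
      then have "\<phi> y \<in> \<phi> ` (U \<inter> Q)"
        using e(2)[of "\<phi> y"] near WE by (auto simp: B_def W_def)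
      then show "y \<in> Q"
        using inj y by (auto simp: B_def inj_on_def)
    qed
    moreover have "{x \<in> topspace E. l1_dist n x (\<phi> z) < e/2} \<subseteq> W"
      using e(2) near by (auto simp: W_def)
    then have "cell X (B z (e/2)) z"
      unfolding B_def
      using chart_ball_is_cell[OF X ch(1) ch(2)[unfolded E_def] hom[unfolded E_def] zw(1), of "e/2"] e(1)
      by (auto simp: E_def)
    ultimately show ?thesis by blast
  qed
  have wB: "w \<in> B w (e/4)"
    using U e(1) by (simp add: B_def)
  show "\<exists>N. openin X N \<and> w \<in> N \<and> (\<forall>z\<in>N. \<exists>V. N \<subseteq> V \<and> V \<subseteq> Q \<and> cell X V z)"
  proof (rule exI[of _ "B w (e/4)"], intro conjI ballI wB)
    have ball: "{x \<in> topspace E. l1_dist n x (\<phi> w) < e/4} \<subseteq> W"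
      using e by (force simp: W_def)
    show "openin X (B w (e/4))"
      using chart_ball_is_cell[OF X ch(1) ch(2)[unfolded E_def] hom[unfolded E_def] U(2), of "e/4"]
        ball e(1) by (auto simp: B_def E_def cell_def)
  next
    fix z assume z: "z \<in> B w (e/4)"
    have "B w (e/4) \<subseteq> B z (e/2)"
    proof
      fix y assume y: "y \<in> B w (e/4)"
      have "l1_dist n (\<phi> y) (\<phi> z) < e/2"
        using l1_dist_triangle[of n "\<phi> y" "\<phi> z" "\<phi> w"] l1_dist_commute[of n "\<phi> w" "\<phi> z"]
          y z e(1) by (simp add: B_def)
      then show "y \<in> B z (e/2)" using y by (simp add: B_def)
    qed
    then show "\<exists>V. B w (e/4) \<subseteq> V \<and> V \<subseteq> Q \<and> cell X V z"
      using cellB[OF z] by blast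
  qed
qed

section \<open>Points with stable pseudo orbits\<close>

text \<open>
  Chain continuity at one scale, in a form that compares two pseudo orbits with each other and not
  with a true orbit.  Asking this for a whole neighbourhood makes the set open, and comparing pseudo
  orbits only makes it robust under perturbation of \<open>f\<close>.
\<close>

definition chain_stable_set :: "'a metric \<Rightarrow> ('a \<Rightarrow> 'a) \<Rightarrow> real \<Rightarrow> 'a set" where
  "chain_stable_set m f \<epsilon> = {p. \<exists>U \<delta>. openin (mtopology_of m) U \<and> p \<in> U \<and> \<delta> > 0 \<and>
     (\<forall>x y. pseudo_orbit m f \<delta> x \<and> pseudo_orbit m f \<delta> y \<and> x 0 \<in> U \<and> y 0 \<in> U \<longrightarrow>
        (\<forall>i. mdist m (x i) (y i) \<le> \<epsilon>))}"

lemma openin_chain_stable_set: "openin (mtopology_of m) (chain_stable_set m f \<epsilon>)"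
proof (subst openin_subopen, intro ballI)
  fix p assume "p \<in> chain_stable_set m f \<epsilon>"
  then obtain U \<delta> where U: "openin (mtopology_of m) U" "p \<in> U" "\<delta> > 0"
    "\<forall>x y. pseudo_orbit m f \<delta> x \<and> pseudo_orbit m f \<delta> y \<and> x 0 \<in> U \<and> y 0 \<in> U \<longrightarrow>
        (\<forall>i. mdist m (x i) (y i) \<le> \<epsilon>)"
    unfolding chain_stable_set_def by blast
  then have "U \<subseteq> chain_stable_set m f \<epsilon>"
    unfolding chain_stable_set_def by blast
  with U show "\<exists>T. openin (mtopology_of m) T \<and> p \<in> T \<and> T \<subseteq> chain_stable_set m f \<epsilon>"
    by blast
qed

lemma mdist_self [simp]: "x \<in> mspace m \<Longrightarrow> mdist m x x = 0"
  by simp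

text \<open>
  The distance of a map to \<open>f\<close> only adds to the jumps: a \<open>\<delta>/2\<close>-pseudo orbit of a map within \<open>\<delta>/2\<close>
  of \<open>f\<close> is a \<open>\<delta>\<close>-pseudo orbit of \<open>f\<close>.  This gives openness in the space of maps.
\<close>

lemma chain_stable_set_persists:
  assumes f: "f \<in> mspace m \<rightarrow> mspace m" and p: "p \<in> chain_stable_set m f \<epsilon>"
  obtains \<delta> where "\<delta> > 0"
    "\<And>g. (\<And>u. u \<in> mspace m \<Longrightarrow> g u \<in> mspace m \<and> mdist m (f u) (g u) \<le> \<delta>) \<Longrightarrow>
       p \<in> chain_stable_set m g \<epsilon>"
proof -
  obtain U \<delta> where U: "openin (mtopology_of m) U" "p \<in> U" "\<delta> > 0"
    "\<And>x y i. pseudo_orbit m f \<delta> x \<Longrightarrow> pseudo_orbit m f \<delta> y \<Longrightarrow> x 0 \<in> U \<Longrightarrow> y 0 \<in> U \<Longrightarrow>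
       mdist m (x i) (y i) \<le> \<epsilon>"
    using p unfolding chain_stable_set_def by blast
  show thesis
  proof (rule that[of "\<delta>/2"])
    fix g assume g: "\<And>u. u \<in> mspace m \<Longrightarrow> g u \<in> mspace m \<and> mdist m (f u) (g u) \<le> \<delta>/2"
    have "pseudo_orbit m f \<delta> x" if x: "pseudo_orbit m g (\<delta>/2) x" for x
      unfolding pseudo_orbit_def
    proof (intro conjI allI)
      show xm: "x i \<in> mspace m" for i using x by (simp add: pseudo_orbit_def)
      fix i
      have "mdist m (f (x i)) (x (Suc i))
          \<le> mdist m (f (x i)) (g (x i)) + mdist m (g (x i)) (x (Suc i))"
        using xm f g by (intro mdist_triangle) auto
      moreover have "mdist m (g (x i)) (x (Suc i)) \<le> \<delta>/2"
        using x by (simp add: pseudo_orbit_def)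
      ultimately show "mdist m (f (x i)) (x (Suc i)) \<le> \<delta>"
        using g[OF xm[of i]] by simp
    qed
    then show "p \<in> chain_stable_set m g \<epsilon>"
      unfolding chain_stable_set_def using U
      by (intro CollectI exI[of _ U] exI[of _ "\<delta>/2"]) auto
  qed (use U(3) in simp)
qed

lemma openin_ball_of:
  assumes "x \<in> mspace m"
  shows "openin (mtopology_of m) {y \<in> mspace m. mdist m x y < r}"
proof -
  interpret Metric_space "mspace m" "mdist m" by (rule Metric_space_mspace_mdist)
  have "{y \<in> mspace m. mdist m x y < r} = mball x r"
    using assms by (auto simp: mball_def)
  then show ?thesis by (simp add: mtopology_of_def)
qed

lemma openin_mtopology_of_ball:
  assumes "openin (mtopology_of m) U" "x \<in> U"
  obtains e where "e > 0" "\<And>y. y \<in> mspace m \<Longrightarrow> mdist m x y < e \<Longrightarrow> y \<in> U"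
proof -
  interpret Metric_space "mspace m" "mdist m" by (rule Metric_space_mspace_mdist)
  obtain e where "e > 0" "mball x e \<subseteq> U"
    using assms by (auto simp: mtopology_of_def openin_mtopology)
  moreover have "x \<in> mspace m" using assms openin_subset by fastforce
  ultimately show thesis using that by (auto simp: mball_def subset_iff)
qed

lemma funpow_in_mspace:
  "f \<in> mspace m \<rightarrow> mspace m \<Longrightarrow> x \<in> mspace m \<Longrightarrow> (f ^^ i) x \<in> mspace m"
  by (induction i) auto

lemma pseudo_orbit_orbit:
  assumes "f \<in> mspace m \<rightarrow> mspace m" "p \<in> mspace m" "0 \<le> \<delta>"
  shows "pseudo_orbit m f \<delta> (\<lambda>i. (f ^^ i) p)"
  unfolding pseudo_orbit_def
proof (intro conjI allI)
  fix i
  show "(f ^^ i) p \<in> mspace m"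
    using funpow_in_mspace[OF assms(1,2)] .
  have "(f ^^ Suc i) p \<in> mspace m"
    using funpow_in_mspace[OF assms(1,2)] .
  then have "mdist m ((f ^^ Suc i) p) ((f ^^ Suc i) p) = 0"
    by (rule mdist_self)
  then show "mdist m (f ((f ^^ i) p)) ((f ^^ Suc i) p) \<le> \<delta>"
    using assms(3) by (simp only: funpow.simps o_apply)
qed

text \<open>
  Continuity of \<open>f\<close> lets the starting point vary: if \<open>x\<close> is a pseudo orbit that starts near \<open>p\<close>,
  then replacing its first entry by \<open>p\<close> changes only the first jump, and by at
  most \<open>d (f p) (f (x 0))\<close>.  So chain continuity at \<open>p\<close> controls all pseudo orbits that start near \<open>p\<close>.
  Conversely, the orbit of \<open>p\<close> is one of the pseudo orbits that are compared.
\<close>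

lemma CC_eq_Inter_chain_stable_set:
  assumes f: "continuous_map (mtopology_of m) (mtopology_of m) f"
  shows "CC m f = (\<Inter>k. chain_stable_set m f (inverse (real (Suc k))))"
proof -
  have fm: "f \<in> mspace m \<rightarrow> mspace m"
    using continuous_map_funspace[OF f] by simp
  show ?thesis
  proof (intro equalityI subsetI)
    fix p assume "p \<in> CC m f"
    then have p: "p \<in> mspace m" "chain_continuous_at m f p" by (auto simp: CC_def)
    show "p \<in> (\<Inter>k. chain_stable_set m f (inverse (real (Suc k))))"
    proof
      fix k
      define \<epsilon> where "\<epsilon> = inverse (real (Suc k))"
      have "\<epsilon> / 2 > 0" by (simp add: \<epsilon>_def)
      then obtain \<delta> where \<delta>: "\<delta> > 0"
        "\<And>x. pseudo_orbit m f \<delta> x \<Longrightarrow> x 0 = p \<Longrightarrow> shadowed_by m f (\<epsilon>/2) x p"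
        using p(2) unfolding chain_continuous_at_def by blast
      define U where "U = {y \<in> mspace m. mdist m p y < \<epsilon>/2} \<inter>
          {y \<in> mspace m. f y \<in> {u \<in> mspace m. mdist m (f p) u < \<delta>/2}}"
      have "openin (mtopology_of m) {y \<in> topspace (mtopology_of m). f y \<in> {u \<in> mspace m. mdist m (f p) u < \<delta>/2}}"
        by (rule openin_continuous_map_preimage[OF f openin_ball_of]) (use p(1) fm in auto)
      then have "openin (mtopology_of m) U"
        unfolding U_def using openin_ball_of[OF p(1), of "\<epsilon>/2"] by (intro openin_Int) auto
      moreover have "p \<in> U"
        using p(1) fm \<delta>(1) \<open>\<epsilon> / 2 > 0\<close> by (auto simp: U_def Pi_iff)
      moreover have near: "mdist m ((f ^^ i) p) (x i) \<le> \<epsilon>/2"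
        if x: "pseudo_orbit m f (\<delta>/2) x" "x 0 \<in> U" for x i
      proof -
        define x' where "x' = x(0 := p)"
        have xm: "x i \<in> mspace m" for i using x(1) by (simp add: pseudo_orbit_def)
        have "mdist m (f (x' i)) (x' (Suc i)) \<le> \<delta>" for i
        proof (cases i)
          case 0
          have "mdist m (f p) (x 1) \<le> mdist m (f p) (f (x 0)) + mdist m (f (x 0)) (x 1)"
            using mdist_triangle[of "f p" m "f (x 0)" "x 1"] fm p xm by auto
          moreover have "mdist m (f p) (f (x 0)) < \<delta>/2"
            using x(2) by (simp add: U_def)
          moreover have "mdist m (f (x 0)) (x 1) \<le> \<delta>/2"
            using x(1) by (simp add: pseudo_orbit_def)
          ultimately show ?thesis using 0 by (simp add: x'_def)
        next
          case (Suc l)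
          have "mdist m (f (x i)) (x (Suc i)) \<le> \<delta>/2"
            using x(1) by (simp add: pseudo_orbit_def)
          then show ?thesis using Suc \<delta>(1) by (simp add: x'_def)
        qed
        then have "pseudo_orbit m f \<delta> x'"
          using xm p by (auto simp: pseudo_orbit_def x'_def)
        then have sh: "mdist m ((f ^^ i) p) (x' i) \<le> \<epsilon>/2"
          using \<delta>(2)[of x'] by (simp add: shadowed_by_def x'_def)
        show ?thesis
        proof (cases "i = 0")
          case True
          then show ?thesis using x(2) by (simp add: U_def)
        next
          case False
          then show ?thesis using sh by (simp add: x'_def)
        qed
      qed
      have "mdist m (x i) (y i) \<le> \<epsilon>"
        if "pseudo_orbit m f (\<delta>/2) x" "pseudo_orbit m f (\<delta>/2) y" "x 0 \<in> U" "y 0 \<in> U" for x y i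
      proof -
        have "mdist m (x i) (y i) \<le> mdist m (x i) ((f ^^ i) p) + mdist m ((f ^^ i) p) (y i)"
          using that funpow_in_mspace[OF fm p(1)]
          by (intro mdist_triangle) (auto simp: pseudo_orbit_def)
        then show ?thesis
          using near[of x i] near[of y i] that mdist_commute[of m "x i"] by simp
      qed
      ultimately show "p \<in> chain_stable_set m f (inverse (real (Suc k)))"
        unfolding chain_stable_set_def \<epsilon>_def[symmetric] using \<delta>(1)
        by (intro CollectI exI[of _ U] exI[of _ "\<delta>/2"]) auto
    qed
  next
    fix p assume p: "p \<in> (\<Inter>k. chain_stable_set m f (inverse (real (Suc k))))"
    have pm: "p \<in> mspace m"
      using p openin_subset[OF openin_chain_stable_set] by fastforce
    have "\<exists>\<delta>>0. \<forall>x. pseudo_orbit m f \<delta> x \<and> x 0 = p \<longrightarrow> shadowed_by m f \<epsilon> x p"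
      if \<epsilon>: "\<epsilon> > 0" for \<epsilon>
    proof -
      obtain k where k: "inverse (real (Suc k)) < \<epsilon>"
        using reals_Archimedean[OF \<epsilon>] by blast
      have "p \<in> chain_stable_set m f (inverse (real (Suc k)))"
        using p by blast
      then obtain U \<delta> where U: "p \<in> U" "\<delta> > 0"
        "\<And>x y i. pseudo_orbit m f \<delta> x \<Longrightarrow> pseudo_orbit m f \<delta> y \<Longrightarrow> x 0 \<in> U \<Longrightarrow> y 0 \<in> U \<Longrightarrow>
          mdist m (x i) (y i) \<le> inverse (real (Suc k))"
        unfolding chain_stable_set_def by blast
      have "shadowed_by m f \<epsilon> x p" if "pseudo_orbit m f \<delta> x" "x 0 = p" for x
        unfolding shadowed_by_def
      proof
        fix i
        have "mdist m ((f ^^ i) p) (x i) \<le> inverse (real (Suc k))"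
          by (rule U(3)[OF pseudo_orbit_orbit[OF fm pm] that(1)]) (use U(1,2) that(2) in auto)
        then show "mdist m ((f ^^ i) p) (x i) \<le> \<epsilon>"
          using k by linarith
      qed
      with U(2) show ?thesis by blast
    qed
    then show "p \<in> CC m f"
      using pm unfolding CC_def chain_continuous_at_def by blast
  qed
qed

lemma gdelta_in_CC:
  assumes "continuous_map (mtopology_of m) (mtopology_of m) f"
  shows "gdelta_in (mtopology_of m) (CC m f)"
  unfolding CC_eq_Inter_chain_stable_set[OF assms]
  by (rule gdelta_in_Inter) (auto intro: open_imp_gdelta_in openin_chain_stable_set)

text \<open>
  Over a bounded time, uniform continuity keeps the accumulated jumps under control.
\<close>

lemma pseudo_orbit_shadowed_finite_time:
  assumes X: "compact_space (mtopology_of m)"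
    and f: "continuous_map (mtopology_of m) (mtopology_of m) f" and "e > 0"
  shows "\<exists>\<delta>>0. \<forall>x. pseudo_orbit m f \<delta> x \<longrightarrow> (\<forall>l\<le>N. mdist m ((f ^^ l) (x 0)) (x l) \<le> e)"
  using \<open>e > 0\<close>
proof (induction N arbitrary: e)
  case 0
  then show ?case
    by (intro exI[of _ 1]) (auto simp: pseudo_orbit_def)
next
  case (Suc N)
  have fm: "f \<in> mspace m \<rightarrow> mspace m"
    using continuous_map_funspace[OF f] by simp
  obtain d where d: "d > 0"
    "\<And>u v. u \<in> mspace m \<Longrightarrow> v \<in> mspace m \<Longrightarrow> mdist m v u < d \<Longrightarrow> mdist m (f v) (f u) < e/2"
    using continuous_imp_uniformly_continuous_map[OF conjI, OF X f] Suc.prems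
    unfolding uniformly_continuous_map_def by (meson half_gt_zero)
  have "min (d/2) e > 0" using d(1) Suc.prems by simp
  from Suc.IH[OF this] obtain \<delta> where \<delta>: "\<delta> > 0"
    "\<And>x l. pseudo_orbit m f \<delta> x \<Longrightarrow> l \<le> N \<Longrightarrow> mdist m ((f ^^ l) (x 0)) (x l) \<le> min (d/2) e"
    by blast
  show ?case
  proof (intro exI[of _ "min \<delta> (e/2)"] conjI allI impI)
    fix x l assume x: "pseudo_orbit m f (min \<delta> (e/2)) x" and l: "l \<le> Suc N"
    have x\<delta>: "pseudo_orbit m f \<delta> x" using x by (auto simp: pseudo_orbit_def)
    have xm: "x i \<in> mspace m" for i using x by (simp add: pseudo_orbit_def)
    have gm: "(f ^^ i) (x 0) \<in> mspace m" for i using funpow_in_mspace[OF fm xm] .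
    show "mdist m ((f ^^ l) (x 0)) (x l) \<le> e"
    proof (cases "l \<le> N")
      case True
      then show ?thesis using \<delta>(2)[OF x\<delta> True] by simp
    next
      case False
      then have [simp]: "l = Suc N" using l by simp
      have "mdist m ((f ^^ N) (x 0)) (x N) < d"
        using \<delta>(2)[OF x\<delta>, of N] d(1) by simp
      then have "mdist m (f ((f ^^ N) (x 0))) (f (x N)) < e/2"
        using d(2) gm xm by blast
      moreover have "mdist m (f (x N)) (x (Suc N)) \<le> e/2"
        using x by (auto simp: pseudo_orbit_def)
      moreover have "mdist m (f ((f ^^ N) (x 0))) (x (Suc N))
          \<le> mdist m (f ((f ^^ N) (x 0))) (f (x N)) + mdist m (f (x N)) (x (Suc N))"
        using gm xm fm by (intro mdist_triangle) auto
      ultimately show ?thesis by simp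
    qed
  qed (use \<delta>(1) Suc.prems in auto)
qed

text \<open>
  The trapping mechanism.  Orbits from \<open>A\<close> run along \<open>u\<close> for the time \<open>a\<close> into the \<open>e\<close>-ball around
  \<open>z\<close>, and the \<open>2e\<close>-ball around \<open>z\<close> runs along \<open>v\<close> and is mapped back into the \<open>e\<close>-ball after the
  time \<open>k\<close>.  Pseudo orbits with small enough jumps err by at most \<open>e\<close> between two checkpoints, and
  the passage from \<open>2e\<close> to \<open>e\<close> absorbs this error at every checkpoint, so that errors never
  accumulate.  Hence all of them stay near the eventually periodic sequence \<open>c\<close> forever.
\<close>

lemma trapped_in_chain_stable_set:
  fixes k a :: nat
  assumes X: "compact_space (mtopology_of m)"
    and g: "continuous_map (mtopology_of m) (mtopology_of m) g"
    and A: "openin (mtopology_of m) A" "p \<in> A" and z: "z \<in> mspace m"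
    and e: "e > 0" "e \<le> \<epsilon> / 4" and k: "k \<ge> 1"
    and u: "\<And>l. l < a \<Longrightarrow> u l \<in> mspace m"
       "\<And>y l. y \<in> A \<Longrightarrow> l < a \<Longrightarrow> mdist m ((g ^^ l) y) (u l) \<le> \<epsilon> / 4"
       "\<And>y. y \<in> A \<Longrightarrow> mdist m ((g ^^ a) y) z < e"
    and v: "\<And>l. l < k \<Longrightarrow> v l \<in> mspace m"
       "\<And>y l. y \<in> mspace m \<Longrightarrow> mdist m y z < 2 * e \<Longrightarrow> l < k \<Longrightarrow> mdist m ((g ^^ l) y) (v l) \<le> \<epsilon> / 4"
       "\<And>y. y \<in> mspace m \<Longrightarrow> mdist m y z < 2 * e \<Longrightarrow> mdist m ((g ^^ k) y) z < e"
  shows "p \<in> chain_stable_set m g \<epsilon>"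
proof -
  have gm: "g \<in> mspace m \<rightarrow> mspace m"
    using continuous_map_funspace[OF g] by simp
  obtain \<delta> where \<delta>: "\<delta> > 0"
    "\<And>x l. pseudo_orbit m g \<delta> x \<Longrightarrow> l \<le> max a k \<Longrightarrow> mdist m ((g ^^ l) (x 0)) (x l) \<le> e"
    using pseudo_orbit_shadowed_finite_time[OF X g e(1)] by metis
  define c where "c t = (if t < a then u t else v ((t - a) mod k))" for t
  have cm: "c t \<in> mspace m" for t
    using u(1) v(1) k by (simp add: c_def)
  have near: "mdist m (x t) (c t) \<le> \<epsilon>/2" if x: "pseudo_orbit m g \<delta> x" "x 0 \<in> A" for x t
  proof -
    have xm: "x i \<in> mspace m" for i using x by (simp add: pseudo_orbit_def)
    have shift: "mdist m (x (s + l)) q \<le> e + mdist m ((g ^^ l) (x s)) q"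
      if "l \<le> max a k" "q \<in> mspace m" for s l q
    proof -
      have "pseudo_orbit m g \<delta> (\<lambda>i. x (s + i))"
        using x(1) by (simp add: pseudo_orbit_def)
      from \<delta>(2)[OF this that(1)] have "mdist m (x (s + l)) ((g ^^ l) (x s)) \<le> e"
        by (simp add: mdist_commute)
      moreover have "mdist m (x (s + l)) q
          \<le> mdist m (x (s + l)) ((g ^^ l) (x s)) + mdist m ((g ^^ l) (x s)) q"
        using xm funpow_in_mspace[OF gm xm] that(2) by (intro mdist_triangle) auto
      ultimately show ?thesis by simp
    qed
    have trap: "mdist m (x (a + j * k)) z < 2 * e" for j
    proof (induction j)
      case 0
      then show ?case using shift[of a z 0] u(3)[OF x(2)] z by simp
    next
      case (Suc j)
      have "x (a + Suc j * k) = x (a + j * k + k)" by (simp add: algebra_simps)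
      then show ?case using shift[of k z "a + j * k"] v(3)[OF xm Suc] z by simp
    qed
    show ?thesis
    proof (cases "t < a")
      case True
      then show ?thesis
        using shift[of t "u t" 0] u(1)[of t] u(2)[OF x(2) True] e True
        by (simp add: c_def le_max_iff_disj)
    next
      case False
      define j l where "j = (t - a) div k" and "l = (t - a) mod k"
      have l: "l < k" "l \<le> max a k" using k by (simp_all add: l_def le_max_iff_disj less_imp_le)
      have "t = a + j * k + l" using False by (simp add: j_def l_def)
      then show ?thesis
        using shift[of l "v l" "a + j * k"] v(1)[OF l(1)] v(2)[OF xm trap l(1), of j] l(2) e False
        by (simp add: c_def l_def)
    qed
  qed
  have "mdist m (x i) (y i) \<le> \<epsilon>"
    if "pseudo_orbit m g \<delta> x" "pseudo_orbit m g \<delta> y" "x 0 \<in> A" "y 0 \<in> A" for x y i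
  proof -
    have "mdist m (x i) (y i) \<le> mdist m (x i) (c i) + mdist m (c i) (y i)"
      using that cm by (intro mdist_triangle) (auto simp: pseudo_orbit_def)
    then show ?thesis
      using near[of x i] near[of y i] that mdist_commute[of m "c i"] by simp
  qed
  then show ?thesis
    unfolding chain_stable_set_def using A \<delta>(1) by blast
qed

lemma openin_itinerary:
  assumes "continuous_map X X f" "\<And>l. l \<le> N \<Longrightarrow> openin X (T l)"
  shows "openin X {y \<in> topspace X. \<forall>l\<le>N. (f ^^ l) y \<in> T l}"
proof -
  have cont: "continuous_map X X (f ^^ l)" for l
  proof (induction l)
    case 0
    then show ?case using continuous_map_id by (simp add: id_def)
  next
    case (Suc l)
    then show ?case using continuous_map_compose[OF Suc assms(1)] by (simp add: o_def)
  qed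
  show ?thesis
    using assms(2)
  proof (induction N)
    case 0
    then show ?case using openin_continuous_map_preimage[OF cont[of 0], of "T 0"] by simp
  next
    case (Suc N)
    have "{y \<in> topspace X. \<forall>l\<le>Suc N. (f ^^ l) y \<in> T l} =
        {y \<in> topspace X. \<forall>l\<le>N. (f ^^ l) y \<in> T l} \<inter> {y \<in> topspace X. (f ^^ Suc N) y \<in> T (Suc N)}"
      by (auto simp: le_Suc_eq)
    then show ?case
      using openin_continuous_map_preimage[OF cont, of "T (Suc N)" "Suc N"] Suc by auto
  qed
qed

lemma funpow_perturbed:
  assumes fX: "f \<in> S \<rightarrow> S" and y: "y \<in> S" and g: "\<And>u. u \<in> S \<Longrightarrow> g u = h (f u)"
    and h: "\<And>u. u \<in> S - C \<Longrightarrow> h u = u"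
    and "\<And>l. 1 \<le> l \<Longrightarrow> l < b \<Longrightarrow> (f ^^ l) y \<notin> C"
  shows "l < b \<Longrightarrow> (g ^^ l) y = (f ^^ l) y" and "1 \<le> b \<Longrightarrow> (g ^^ b) y = h ((f ^^ b) y)"
proof -
  have fS: "(f ^^ l) y \<in> S" for l
    using fX y by (induction l) auto
  show eq: "(g ^^ l) y = (f ^^ l) y" if "l < b" for l
    using that
  proof (induction l)
    case (Suc l)
    then show ?case using g[OF fS[of l]] h[of "(f ^^ Suc l) y"] fS[of "Suc l"] assms(5)[of "Suc l"] by simp
  qed simp
  show "(g ^^ b) y = h ((f ^^ b) y)" if "1 \<le> b"
    using eq[of "b - 1"] that g[OF fS[of "b - 1"]] by (cases b) auto
qed

section \<open>Closing up an orbit by a small perturbation\<close>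

text \<open>
  The orbit of \<open>p \<in> B\<close> accumulates somewhere, so it has two entries \<open>x i\<close> and \<open>x j\<close> in one small
  cell \<open>V\<close> with centre \<open>z = x i\<close>.  Thus \<open>p\<close> enters \<open>V\<close>, for the first time at \<open>a\<close>, and \<open>z\<close> returns
  to \<open>V\<close>, for the first time at \<open>k\<close>.  Follow \<open>f\<close> by a homeomorphism \<open>h\<close> that is supported in \<open>V\<close>
  and squeezes neighbourhoods of both entry points into a tiny ball around \<open>z\<close>.  Because \<open>a\<close> and
  \<open>k\<close> are first entry times, \<open>h\<close> does not disturb the orbits earlier, and so the perturbed map
  traps a neighbourhood of \<open>p\<close> in a periodic cycle of small sets around the orbit of \<open>z\<close>.
\<close>

lemma closing_perturbation:
  assumes cells: "small_cells X"
    and X: "compact_space X" "mtopology_of m = X"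
    and f: "continuous_map X X f" and B: "openin X B" "B \<noteq> {}" and "\<epsilon> > 0" "\<eta> > 0"
  obtains h where "homeomorphic_map X X h" "\<And>y. y \<in> mspace m \<Longrightarrow> mdist m y (h y) < \<eta>"
    "\<And>g. (\<And>y. y \<in> mspace m \<Longrightarrow> g y = h (f y)) \<Longrightarrow> chain_stable_set m g \<epsilon> \<inter> B \<noteq> {}"
proof -
  interpret Metric_space "mspace m" "mdist m" by (rule Metric_space_mspace_mdist)
  have XM: "mtopology = X" using X(2) by (simp add: mtopology_of_def)
  have topX[simp]: "topspace X = mspace m" using X(2) topspace_mtopology_of by metis
  have fm: "f \<in> mspace m \<rightarrow> mspace m"
    using continuous_map_funspace[OF f] by simp
  obtain p where p: "p \<in> B" using B by blast
  then have pm: "p \<in> mspace m" using B(1) openin_subset by fastforce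
  define x where "x l = (f ^^ l) p" for l
  have xm: "x l \<in> mspace m" for l
    unfolding x_def using funpow_in_mspace[OF fm pm] .
  obtain w r where w: "w \<in> mspace m" "strict_mono r"
      "limitin X ((\<lambda>l. x (Suc l)) \<circ> r) w sequentially"
    using X(1) xm unfolding XM[symmetric] compact_space_sequentially by (metis image_subsetI)
  define Q where "Q = {y \<in> mspace m. mdist m w y < \<eta>/2}"
  have "openin X Q" "w \<in> Q"
    using openin_ball_of[OF w(1), of "\<eta>/2"] X(2) w(1) \<open>\<eta> > 0\<close> unfolding Q_def by auto
  then obtain N where N: "openin X N" "w \<in> N"
    "\<And>z. z \<in> N \<Longrightarrow> \<exists>V. N \<subseteq> V \<and> V \<subseteq> Q \<and> cell X V z"
    using cells unfolding small_cells_def by metis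
  have "\<forall>\<^sub>F l in sequentially. ((\<lambda>l. x (Suc l)) \<circ> r) l \<in> N"
    using w(3) N(1,2) by (simp add: limitin_def)
  then obtain l0 where l0: "\<And>l. l \<ge> l0 \<Longrightarrow> x (Suc (r l)) \<in> N"
    by (auto simp: eventually_sequentially)
  (* Times are at least 1, as h acts only after f: if p is in V, the start p itself
     is not squeezed, only its later images are. *)
  define i where "i = Suc (r l0)"
  define j where "j = Suc (r (Suc l0))"
  have ij: "1 \<le> i" "i < j" "x i \<in> N" "x j \<in> N"
    using l0[of l0] l0[of "Suc l0"] w(2) by (auto simp: i_def j_def strict_mono_Suc_iff)
  define z where "z = x i"
  have zm: "z \<in> mspace m" by (simp add: z_def xm)
  obtain V where V: "N \<subseteq> V" "V \<subseteq> Q" "cell X V z"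
    using N(3) ij(3) z_def by blast
  define a where "a = (LEAST l. 1 \<le> l \<and> x l \<in> V)"
  have "1 \<le> a \<and> x a \<in> V"
    unfolding a_def by (rule LeastI[of _ i]) (use ij V(1) in blast)
  then have a: "1 \<le> a" "x a \<in> V" by blast+
  have before_a: "x l \<notin> V" if "1 \<le> l" "l < a" for l
    using not_less_Least that unfolding a_def by blast
  define y where "y l = (f ^^ l) z" for l
  have ym: "y l \<in> mspace m" for l
    unfolding y_def using funpow_in_mspace[OF fm zm] .
  have "y (j - i) = (f ^^ (j - i + i)) p"
    by (simp only: y_def z_def x_def funpow_add o_apply)
  then have "y (j - i) = x j"
    using ij(2) by (simp add: x_def)
  then have return: "1 \<le> j - i \<and> y (j - i) \<in> V"
    using ij V(1) by auto
  define k where "k = (LEAST l. 1 \<le> l \<and> y l \<in> V)"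
  have "1 \<le> k \<and> y k \<in> V"
    unfolding k_def by (rule LeastI[of _ "j - i"]) (rule return)
  then have k: "1 \<le> k" "y k \<in> V" by blast+
  have before_k: "y l \<notin> V" if "1 \<le> l" "l < k" for l
    using not_less_Least that unfolding k_def by blast
  obtain C P where C: "closedin X C" "C \<subseteq> V" and P: "openin X P" "{x a, y k} \<subseteq> P"
    and squeeze: "\<And>D. openin X D \<Longrightarrow> z \<in> D \<Longrightarrow>
           \<exists>h. homeomorphic_map X X h \<and> (\<forall>y\<in>topspace X - C. h y = y) \<and> h ` C \<subseteq> C \<and> h ` P \<subseteq> D"
    using V(3) a(2) k(2) unfolding cell_def by (metis finite.intros(1) finite_insert insert_subset empty_subsetI)
  (* I b q: points that follow q for the time b, avoid the support of h in between, and are in P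
     at time b, where h will squeeze them.  It serves both for p (b = a) and for z (b = k). *)
  define T where "T b q l = (if l = b then P else {u \<in> mspace m. mdist m (q l) u < \<epsilon>/4} \<inter>
      (if l = 0 then mspace m else mspace m - C))" for b :: nat and q :: "nat \<Rightarrow> 'a" and l
  define I where "I b q = {u \<in> mspace m. \<forall>l\<le>b. (f ^^ l) u \<in> T b q l}" for b q
  have openI: "openin X (I b q)" if "\<And>l. q l \<in> mspace m" for b q
  proof -
    have "openin X (T b q l)" for l
      using P(1) C(1) openin_ball_of[OF that, of l "\<epsilon>/4"] X(2) openin_topspace[of X]
      by (auto simp: T_def intro!: openin_Int openin_diff)
    from openin_itinerary[OF f this, where N=b] show ?thesis by (simp add: I_def)
  qed
  have pI: "p \<in> I a x"
    using pm xm P(2) before_a C(2) \<open>\<epsilon> > 0\<close> by (auto simp: I_def T_def x_def[symmetric])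
  have zI: "z \<in> I k y"
    using zm ym P(2) before_k C(2) \<open>\<epsilon> > 0\<close> by (auto simp: I_def T_def y_def[symmetric])
  obtain e0 where e0: "e0 > 0" "\<And>u. u \<in> mspace m \<Longrightarrow> mdist m z u < e0 \<Longrightarrow> u \<in> I k y"
    using openin_mtopology_of_ball[of m "I k y" z] openI[of y k] ym zI X(2) by metis
  define e where "e = min (e0/2) (\<epsilon>/4)"
  have e: "e > 0" "e \<le> \<epsilon>/4" "2 * e \<le> e0"
    using e0(1) \<open>\<epsilon> > 0\<close> by (auto simp: e_def)
  define D where "D = {u \<in> mspace m. mdist m z u < e}"
  have "openin X D" "z \<in> D"
    using openin_ball_of[OF zm] X(2) zm e(1) by (auto simp: D_def)
  from squeeze[OF this] obtain h where h: "homeomorphic_map X X h"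
    "\<And>u. u \<in> mspace m - C \<Longrightarrow> h u = u" "h ` C \<subseteq> C" "h ` P \<subseteq> D" by auto
  show thesis
  proof (rule that[OF h(1)])
    fix u assume u: "u \<in> mspace m"
    show "mdist m u (h u) < \<eta>"
    proof (cases "u \<in> C")
      case True
      then have "u \<in> Q" "h u \<in> Q" using C(2) V(2) h(3) by auto
      then have *: "h u \<in> mspace m" "mdist m w u < \<eta>/2" "mdist m w (h u) < \<eta>/2"
        by (auto simp: Q_def)
      then have "mdist m u (h u) \<le> mdist m u w + mdist m w (h u)"
        using w(1) u by (intro mdist_triangle) auto
      then show ?thesis using * mdist_commute[of m u w] by simp
    next
      case False
      then show ?thesis using h(2) u \<open>\<eta> > 0\<close> by simp
    qed
  next
    fix g assume g: "\<And>y. y \<in> mspace m \<Longrightarrow> g y = h (f y)"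
    have "continuous_map X X (h \<circ> f)"
      using f h(1) continuous_map_compose homeomorphic_imp_continuous_map by blast
    then have gc: "continuous_map X X g"
      by (rule continuous_map_eq) (simp add: g)
    have follow: "(\<forall>l<b. (g ^^ l) u = (f ^^ l) u \<and> mdist m ((g ^^ l) u) (q l) \<le> \<epsilon>/4) \<and>
        mdist m ((g ^^ b) u) z < e"
      if u: "u \<in> I b q" and b: "1 \<le> b" for u b q
    proof -
      have um: "u \<in> mspace m" and it: "\<And>l. l \<le> b \<Longrightarrow> (f ^^ l) u \<in> T b q l"
        using u by (auto simp: I_def)
      have notC: "(f ^^ l) u \<notin> C" if "1 \<le> l" "l < b" for l
        using it[of l] that by (auto simp: T_def)
      have g_eq: "(g ^^ l) u = (f ^^ l) u" if "l < b" for l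
        by (rule funpow_perturbed(1)[where C = C and b = b and h = h, OF fm um])
          (use g h(2) notC that in blast)+
      have "(g ^^ b) u = h ((f ^^ b) u)"
        by (rule funpow_perturbed(2)[where C = C, OF fm um]) (use g h(2) notC b in blast)+
      moreover have "(f ^^ b) u \<in> P"
        using it[of b] by (simp add: T_def)
      ultimately have "(g ^^ b) u \<in> D"
        using h(4) by auto
      moreover have "mdist m ((g ^^ l) u) (q l) \<le> \<epsilon>/4" if "l < b" for l
        using g_eq[OF that] it[of l] that by (simp add: T_def mdist_commute)
      ultimately show ?thesis
        using g_eq by (auto simp: D_def mdist_commute)
    qed
    have "p \<in> chain_stable_set m g \<epsilon>"
    proof (rule trapped_in_chain_stable_set[where A = "I a x" and u = x and v = y and a = a and k = k])
      show "compact_space (mtopology_of m)" "continuous_map (mtopology_of m) (mtopology_of m) g"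
          "openin (mtopology_of m) (I a x)"
        using X gc openI xm by auto
      have near_z: "u \<in> I k y" if "u \<in> mspace m" "mdist m u z < 2 * e" for u
        using e0(2)[of u] e(3) that by (simp add: mdist_commute[of m z])
      then show "mdist m ((g ^^ l) u) (y l) \<le> \<epsilon>/4"
        if "u \<in> mspace m" "mdist m u z < 2 * e" "l < k" for u l
        using follow k(1) that by blast
      show "mdist m ((g ^^ k) u) z < e"
        if "u \<in> mspace m" "mdist m u z < 2 * e" for u
        using follow k(1) near_z[OF that] by blast
      show "mdist m ((g ^^ l) u) (x l) \<le> \<epsilon>/4" if "u \<in> I a x" "l < a" for u l
        using follow a(1) that by blast
      show "mdist m ((g ^^ a) u) z < e" if "u \<in> I a x" for u
        using follow a(1) that by blast
    qed (use pI zm e k(1) xm ym in auto)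
    then show "chain_stable_set m g \<epsilon> \<inter> B \<noteq> {}"
      using p by blast
  qed
qed

section \<open>Genericity\<close>

text \<open>
  For each nonempty \<open>B\<close> in a countable base and each scale \<open>1/(k+1)\<close>, the maps whose stable set there
  meets \<open>B\<close> form an open dense set.  For a map in all of them, the stable sets at all scales are open
  and dense, and the Baire category theorem in \<open>X\<close> shows that their intersection, the set of points
  of chain continuity, is dense.  Density in \<open>S\<close> asks only that \<open>S\<close> is closed under composition with
  homeomorphisms from the left, which covers homeomorphisms and continuous maps alike.
\<close>

lemma generic_almost_chain_continuous:
  assumes cells: "small_cells X"
    and X: "compact_space X" "Hausdorff_space X" "second_countable X" "mtopology_of m = X"
    and S: "S \<subseteq> mspace (cfunspace X m)"
    and comp: "\<And>f h. f \<in> S \<Longrightarrow> homeomorphic_map X X h \<Longrightarrow> restrict (h \<circ> f) (topspace X) \<in> S"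
  shows "generic_in (subtopology (mtopology_of (cfunspace X m)) S) (almost_chain_continuous m)"
proof -
  define Fm where "Fm = cfunspace X m"
  have topX[simp]: "topspace X = mspace m" using X(4) topspace_mtopology_of by metis
  have cont: "continuous_map X X f" if "f \<in> S" for f
    using S that X(4) by auto
  have topT: "topspace (subtopology (mtopology_of Fm) S) = S"
    using S by (simp only: topspace_subtopology topspace_mtopology_of Fm_def) auto
  obtain \<B> where \<B>: "countable \<B>" "\<And>V. V \<in> \<B> \<Longrightarrow> openin X V"
      "\<And>U x. openin X U \<Longrightarrow> x \<in> U \<Longrightarrow> \<exists>V\<in>\<B>. x \<in> V \<and> V \<subseteq> U"
    using X(3) unfolding second_countable_def by metis
  (* The empty set is inserted because an enumeration needs a nonempty set: X may be empty. *)
  define b where "b = from_nat_into (insert {} \<B>)"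
  have bran: "range b = insert {} \<B>"
    unfolding b_def using \<B>(1) by (intro range_from_nat_into) auto
  have bopen: "openin X (b i)" for i
    using bran \<B>(2) by (metis insertE openin_empty rangeI)
  define ep where "ep i = inverse (real (Suc i))" for i
  have ep: "ep i > 0" for i by (simp add: ep_def)
  define \<U> where "\<U> i = {f \<in> S. b (fst (prod_decode i)) \<noteq> {} \<longrightarrow>
      chain_stable_set m f (ep (snd (prod_decode i))) \<inter> b (fst (prod_decode i)) \<noteq> {}}" for i
  have opn: "openin (subtopology (mtopology_of Fm) S) (\<U> i)" for i
  proof -
    define B where "B = b (fst (prod_decode i))"
    define \<epsilon> where "\<epsilon> = ep (snd (prod_decode i))"
    define O' where "O' = {f \<in> mspace Fm. B \<noteq> {} \<longrightarrow> chain_stable_set m f \<epsilon> \<inter> B \<noteq> {}}"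
    interpret F: Metric_space "mspace Fm" "mdist Fm" by (rule Metric_space_mspace_mdist)
    have "openin (mtopology_of Fm) O'"
      unfolding mtopology_of_def F.openin_mtopology
    proof (intro conjI allI impI)
      fix f assume f: "f \<in> O'"
      show "\<exists>r>0. F.mball f r \<subseteq> O'"
      proof (cases "B = {}")
        case True
        then show ?thesis
          by (intro exI[of _ 1]) (auto simp: O'_def)
      next
        case False
        then have ne: "topspace X \<noteq> {}"
          using bopen openin_subset unfolding B_def by blast
        obtain p where p: "p \<in> B" "p \<in> chain_stable_set m f \<epsilon>"
          using f False unfolding O'_def by blast
        obtain \<delta> where \<delta>: "\<delta> > 0"
          "\<And>g. (\<And>u. u \<in> mspace m \<Longrightarrow> g u \<in> mspace m \<and> mdist m (f u) (g u) \<le> \<delta>) \<Longrightarrow>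
             p \<in> chain_stable_set m g \<epsilon>"
          using chain_stable_set_persists[OF _ p(2)] f by (auto simp: O'_def Fm_def)
        have "g \<in> O'" if g: "g \<in> F.mball f \<delta>" for g
        proof -
          have fg: "f \<in> mspace Fm" "g \<in> mspace Fm" "mdist Fm f g \<le> \<delta>"
            using g by auto
          then have "g u \<in> mspace m \<and> mdist m (f u) (g u) \<le> \<delta>" if "u \<in> mspace m" for u
            using cfunspace_mdist_le[of f X m g \<delta>] ne that by (auto simp: Fm_def)
          from \<delta>(2)[OF this] show ?thesis
            using fg p(1) by (auto simp: O'_def)
        qed
        then show ?thesis using \<delta>(1) by blast
      qed
    qed (auto simp: O'_def)
    moreover have "\<U> i = O' \<inter> S"
      using S by (auto simp: \<U>_def O'_def B_def \<epsilon>_def Fm_def)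
    ultimately show ?thesis
      unfolding openin_subtopology by blast
  qed
  have dense: "subtopology (mtopology_of Fm) S closure_of (\<U> i) = S" for i
  proof -
    define B where "B = b (fst (prod_decode i))"
    define \<epsilon> where "\<epsilon> = ep (snd (prod_decode i))"
    have "\<U> i \<inter> T \<noteq> {}" if T: "openin (subtopology (mtopology_of Fm) S) T" "T \<noteq> {}" for T
    proof (cases "B = {}")
      case True
      then have "\<U> i = S" by (auto simp: \<U>_def B_def)
      then show ?thesis using T openin_subset topT by blast
    next
      case False
      then have ne: "topspace X \<noteq> {}"
        using bopen openin_subset unfolding B_def by blast
      obtain T' where T': "openin (mtopology_of Fm) T'" "T = T' \<inter> S"
        using T(1) unfolding openin_subtopology by blast
      then obtain f where f: "f \<in> T'" "f \<in> S" using T(2) by blast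
      obtain \<eta> where \<eta>: "\<eta> > 0" "\<And>g. g \<in> mspace Fm \<Longrightarrow> mdist Fm f g < \<eta> \<Longrightarrow> g \<in> T'"
        using openin_mtopology_of_ball[OF T'(1) f(1)] by metis
      have "openin X B" "\<eta> / 2 > 0" using bopen \<eta>(1) by (auto simp: B_def)
      then obtain h where h: "homeomorphic_map X X h"
        "\<And>y. y \<in> mspace m \<Longrightarrow> mdist m y (h y) < \<eta> / 2"
        "\<And>g. (\<And>y. y \<in> mspace m \<Longrightarrow> g y = h (f y)) \<Longrightarrow> chain_stable_set m g \<epsilon> \<inter> B \<noteq> {}"
        using closing_perturbation[OF cells X(1,4) cont[OF f(2)] \<open>openin X B\<close> False ep, of "\<eta>/2"]
        unfolding \<epsilon>_def by metis
      define g where "g = restrict (h \<circ> f) (topspace X)"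
      have g: "g y = h (f y)" if "y \<in> mspace m" for y
        using that by (simp add: g_def)
      have gS: "g \<in> S" unfolding g_def by (rule comp[OF f(2) h(1)])
      have "f y \<in> mspace m" if "y \<in> mspace m" for y
        using continuous_map_funspace[OF cont[OF f(2)]] that by auto
      then have "\<forall>y\<in>topspace X. mdist m (f y) (g y) \<le> \<eta>/2"
        using h(2) g by (simp add: less_imp_le)
      then have "mdist Fm f g \<le> \<eta>/2"
        using cfunspace_mdist_le[of f X m g "\<eta>/2"] f(2) gS S ne unfolding Fm_def by blast
      then have "g \<in> T'"
        using \<eta> gS S by (auto simp: Fm_def)
      moreover have "g \<in> \<U> i"
        using gS h(3)[of g] g by (simp add: \<U>_def B_def \<epsilon>_def)
      ultimately show ?thesis using T'(2) gS by blast
    qed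
    then show ?thesis
      using dense_intersects_open[of "subtopology (mtopology_of Fm) S" "\<U> i"] topT by auto
  qed
  have acc: "almost_chain_continuous m f" if f: "f \<in> (\<Inter>i. \<U> i)" for f
  proof -
    have fS: "f \<in> S" using f by (auto simp: \<U>_def)
    have CC: "CC m f = (\<Inter>k. chain_stable_set m f (ep k))"
      unfolding ep_def by (rule CC_eq_Inter_chain_stable_set) (use cont[OF fS] X(4) in simp)
    have stable_dense: "X closure_of chain_stable_set m f (ep k) = topspace X" for k
      unfolding dense_intersects_open
    proof (intro allI impI)
      fix T assume T: "openin X T \<and> T \<noteq> {}"
      then obtain u V where V: "V \<in> \<B>" "u \<in> V" "V \<subseteq> T" using \<B>(3) by blast
      then obtain j where j: "b j = V" using bran by (metis imageE insertI2)
      have "f \<in> \<U> (prod_encode (j, k))" using f by blast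
      then show "chain_stable_set m f (ep k) \<inter> T \<noteq> {}"
        using V j by (auto simp: \<U>_def)
    qed
    have "X closure_of \<Inter>(range (\<lambda>k. chain_stable_set m f (ep k))) = topspace X"
    proof (rule Baire_category)
      show "completely_metrizable_space X \<or> locally_compact_space X \<and> regular_space X"
        using X compact_Hausdorff_imp_regular_space compact_imp_locally_compact_space by blast
    qed (use openin_chain_stable_set[of m f] X(4) stable_dense in auto)
    then show ?thesis
      using gdelta_in_CC[of m f] cont[OF fS] X(4) CC
      by (simp add: almost_chain_continuous_def)
  qed
  show ?thesis
    unfolding generic_in_def Fm_def[symmetric] topT
  proof (intro exI[of _ \<U>] conjI allI opn dense)
    show "\<Inter> (range \<U>) \<subseteq> {f \<in> S. almost_chain_continuous m f}"
      using acc by (auto simp: \<U>_def)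
  qed
qed

theorem corollary1p1:
  fixes X :: "'a topology"
    and \<A> :: "('a set \<times> ('a \<Rightarrow> nat \<Rightarrow> real)) set"
    and n :: nat and r :: enat
    and m :: "'a metric"
  assumes "closed_Cr_manifold n r X \<A>" and "1 \<le> r"
    and "mtopology_of m = X"
  shows "generic_in (homeo_space m) (almost_chain_continuous m) \<and>
         generic_in (cmap_space m) (almost_chain_continuous m)"
proof -
  have X: "compact_space X" "Hausdorff_space X" "second_countable X"
    using assms(1) by (auto simp: closed_Cr_manifold_def)
  define F where "F = mspace (cfunspace X m)"
  define H where "H = {f \<in> F. homeomorphic_map X X f}"
  have topX: "topspace X = mspace m" using assms(3) topspace_mtopology_of by metis
  have cells: "small_cells X"
    using assms(1) by (rule closed_manifold_small_cells)
  have F: "f \<in> F \<longleftrightarrow> f \<in> extensional (topspace X) \<and> continuous_map X X f" for f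
  proof -
    interpret Metric_space "mspace m" "mdist m" by (rule Metric_space_mspace_mdist)
    have XM: "mtopology = X" using assms(3) by (simp add: mtopology_of_def)
    have "mbounded (f ` topspace X)" if "continuous_map X X f"
    proof -
      have "compactin X (f ` topspace X)"
        using that X(1) image_compactin by (metis compact_space_def)
      then show ?thesis using compactin_imp_mbounded XM by blast
    qed
    then show ?thesis
      using assms(3) topX continuous_map_funspace[of X X f] by (auto simp: F_def)
  qed
  have cont: "continuous_map X X (restrict (h \<circ> f) (topspace X))"
    if "continuous_map X X f" "homeomorphic_map X X h" for f h
    using that continuous_map_compose homeomorphic_imp_continuous_map
    by (metis continuous_map_eq restrict_apply)
  have "generic_in (subtopology (mtopology_of (cfunspace X m)) F) (almost_chain_continuous m)"
  proof (rule generic_almost_chain_continuous[OF cells X assms(3)])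
    show "restrict (h \<circ> f) (topspace X) \<in> F" if "f \<in> F" "homeomorphic_map X X h" for f h
      using that F cont by blast
  qed (auto simp: F_def)
  moreover have "subtopology (mtopology_of (cfunspace X m)) F = cmap_space m"
    unfolding F_def cmap_space_def assms(3)
    by (metis subtopology_topspace topspace_mtopology_of)
  moreover have "generic_in (subtopology (mtopology_of (cfunspace X m)) H) (almost_chain_continuous m)"
  proof (rule generic_almost_chain_continuous[OF cells X assms(3)])
    show "H \<subseteq> mspace (cfunspace X m)" by (auto simp: H_def F_def)
    show "restrict (h \<circ> f) (topspace X) \<in> H" if "f \<in> H" "homeomorphic_map X X h" for f h
    proof -
      have "homeomorphic_map X X (restrict (h \<circ> f) (topspace X))"
        using that homeomorphic_map_compose[of X X f X h]
        by (auto simp: H_def intro: homeomorphic_map_eq)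
      then show ?thesis using that F cont by (auto simp: H_def)
    qed
  qed
  moreover have "subtopology (mtopology_of (cfunspace X m)) H = homeo_space m"
  proof -
    have "H = topspace (cmap_space m) \<inter> {f. homeomorphic_map X X f}"
      unfolding H_def F_def cmap_space_def assms(3) by auto
    then show ?thesis
      unfolding homeo_space_def cmap_space_def assms(3) by (metis subtopology_restrict)
  qed
  ultimately show ?thesis by simp
qed

end
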